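(* Let $p:\mathcal E\to\mathcal I$ be a monoidal closed fibration and $q:\mathcal D\to\mathcal J$ a type refinement system, and let $(L\dashv R):p\dashv q$ be an adjunction of type refinement systems giving rise to a strong monad on $p$. Suppose $U\sqsubset C$ is a universal type in $q$ (with encodings $(e_S)_S$) which is reflected across the adjunction. Then for every e-type $T\sqsubset B$ of $p$ there is a vertical isomorphism $$\eta_B^{*}\big(R_1L_1T\big)\;\equiv\;\mathrm{shift}_{B,R_0C}^{*}\Big(\big(R_1U/T\big)\backslash R_1U\Big).$$
   Context: A type refinement system is a functor $p:\mathcal E\to\mathcal I$. Objects of $\mathcal I$ are i-types, morphisms of $\mathcal I$ are expressions; objects of $\mathcal E$ are e-types, morphisms of $\mathcal E$ are derivations. Composition is written diagrammatically ($f;g$ means $f$ then $g$). $S\sqsubset A$ ("$S$ refines $A$") means $p(S)=A$. For $f:A\to B$, $S\sqsubset A$, $T\sqsubset B$, a derivation of the typing judgment $S\Rightarrow_f T$ is a morphism $\alpha:S\to T$ in $\mathcal E$ with $p(\alpha)=f$. For $S,T\sqsubset A$, the subtyping judgment $S\le T$ is $S\Rightarrow_{\mathrm{id}_A}T$; $S\equiv T$ (vertical isomorphism) means there are derivations of $S\le T$ and $T\le S$ which compose (both ways) to identities. Pullback: for $f:A\to B$ and $T\sqsubset B$, a pullback of $T$ along $f$ is an e-type $f^*T\sqsubset A$ with a derivation $\ell$ of $f^*T\Rightarrow_f T$ and, for every e-type $S$ and expression $g:p(S)\to A$, a function $\beta\mapsto R(\beta)$ from derivations of $S\Rightarrow_{g;f}T$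 to derivations of $S\Rightarrow_g f^*T$, such that $R(\beta);\ell=\beta$ and $R(\eta;\ell)=\eta$ for all such $\beta$ and all derivations $\eta$ of $S\Rightarrow_g f^*T$ (equivalently, $\ell$ is a cartesian morphism over $f$). Pullbacks are unique up to $\equiv$. We say a derivation $\ell$ of $S\Rightarrow_f T$ exhibits $S$ as a pullback of $T$ along $f$ if it is the derivation $\ell$ of such a structure. A fibration is a type refinement system with all pullbacks. Monoidal closed structure on $\mathcal I$: monoidal product $\otimes$, unit $\mathbf 1$; for objects $A,C$ a left residual $A\backslash C$ with $\mathrm{ev}^l:A\otimes(A\backslash C)\to C$ and a natural bijection $\lambda$ from maps $A\otimes X\to C$ to maps $X\to A\backslash C$ with $(\mathrm{id}\otimes\lambda f);\mathrm{ev}^l=f$, $\lambda((\mathrm{id}\otimes g);\mathrm{ev}^l)=g$; and a right residual $C/B$ with $\mathrm{ev}^r:(C/B)\otimes B\to C$ and a bijection $\rho$ from maps $X\otimes B\to C$ to maps $X\to C/B$ with $(\rho f\otimes\mathrm{id});\mathrm{ev}^r=f$, $\rho((g\otimes \mathrm{id});\mathrm{ev}^r)=g$. Define $\mathrm{shift}_{B,C}:=\lambda(\mathrm{ev}^r):B\to (C/B)\backslash C$. A monoidal closed type refinement system is a strong monoidal functor $p$ (monoidal product on $\mathcal E$ also written $\otimes$, with $S\otimes T\sqsubset A\otimes B$ when $S\sqsubset A,T\sqsubset B$, and $\mathbf 1\sqsubset\mathbf 1$) over a monoidal closed $\mathcal I$ such that for all $S\sqsubset A$, $U\sqsubset C$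 there is an e-type $S\backslash U\sqsubset A\backslash C$ with a derivation $\mathrm{ev}^l_{S,U}$ of $S\otimes(S\backslash U)\Rightarrow_{\mathrm{ev}^l}U$ and an operation $\Lambda$ sending derivations $\beta$ of $S\otimes X\Rightarrow_f U$ to derivations of $X\Rightarrow_{\lambda f}S\backslash U$ with $(\mathrm{id}_S\otimes\Lambda\beta);\mathrm{ev}^l_{S,U}=\beta$ and $\Lambda((\mathrm{id}_S\otimes\eta);\mathrm{ev}^l_{S,U})=\eta$; and symmetrically, for $T\sqsubset B$, an e-type $U/T\sqsubset C/B$ with derivation $\mathrm{ev}^r_{U,T}$ of $(U/T)\otimes T\Rightarrow_{\mathrm{ev}^r}U$ and an operation $P$ from derivations $\beta$ of $X\otimes T\Rightarrow_f U$ to derivations of $X\Rightarrow_{\rho f}U/T$ with the analogous two equations. A monoidal closed fibration is such a system with all pullbacks, where $\otimes$ preserves pullbacks (the canonical derivation $f_1^*T_1\otimes f_2^*T_2\le (f_1\otimes f_2)^*(T_1\otimes T_2)$ is a vertical isomorphism). Adjunction of type refinement systems $(L\dashv R):p\dashv q$ for $p:\mathcal E\to\mathcal I$, $q:\mathcal D\to\mathcal J$ (objects of $\mathcal D$: d-types, of $\mathcal J$: j-types): functors $L_0:\mathcal I\to\mathcal J$, $L_1:\mathcal E\to\mathcal D$, $R_0:\mathcal J\to\mathcal I$, $R_1:\mathcal D\to\mathcal E$ with $qL_1=L_0p$, $pR_1=R_0q$, adjunctions $L_0\dashv R_0$ and $L_1\dashv R_1$ (units $\eta$, counits $\epsilon$)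 with $p(\eta_S)=\eta_{p(S)}$ and $q(\epsilon_T)=\epsilon_{q(T)}$. It gives rise to a strong monad on $p$ if the monad $R_0L_0$ carries a strength $\sigma_{A,B}:A\otimes R_0L_0B\to R_0L_0(A\otimes B)$ and the monad $R_1L_1$ carries a strength $\sigma_{S,T}:S\otimes R_1L_1T\to R_1L_1(S\otimes T)$, each compatible with unit and multiplication, with $p(\sigma_{S,T})=\sigma_{p S,p T}$. For d-types $S\sqsubset A$, $U\sqsubset C$ of $q$, an encoding of $S$ in $U$ is an expression $e_S:A\to C$ of $\mathcal J$ such that $S$ is a $q$-pullback of $U$ along $e_S$. A universal type in $q$ is a d-type $U$ with an encoding $e_S$ of every d-type $S$ in $U$. $U\sqsubset C$ is reflected across the adjunction if (1) $R$ preserves $q$-pullbacks (whenever a derivation $\alpha$ of $S\Rightarrow_f T$ exhibits $S$ as a $q$-pullback of $T$ along $f$, $R_1\alpha$ exhibits $R_1S$ as a $p$-pullback of $R_1T$ along $R_0f$), and (2) for each e-type $T\sqsubset B$ of $p$, the e-type $(R_1U/T)\backslash R_1U$ is the $p$-pullback of $R_1U$ along the expression $(R_0C/B)\backslash R_0C\cong \mathbf 1\otimes((R_0C/B)\backslash R_0C)\xrightarrow{\rho(\eta_B;R_0e_{L_1T})\otimes\mathrm{id}}(R_0C/B)\otimes((R_0C/B)\backslash R_0C)\xrightarrow{\mathrm{ev}^l}R_0C$, where $\eta_B;R_0e_{L_1T}:B\to R_0C$ is regarded as a map $\mathbf 1\otimes B\to R_0C$. *)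

theory Defs
  imports Main
begin

section \<open>Categories, functors, adjunctions\<close>

text \<open>Composition is diagrammatic throughout: \<open>f ;; g\<close> is first \<open>f\<close>, then \<open>g\<close>.\<close>

record ('o, 'a) cat =
  Obj :: "'o set"
  Arr :: "'a set"
  Dom :: "'a \<Rightarrow> 'o"
  Cod :: "'a \<Rightarrow> 'o"
  Idn :: "'o \<Rightarrow> 'a"
  Comp :: "'a \<Rightarrow> 'a \<Rightarrow> 'a" (infixr ";;\<index>" 55)

definition hom :: "('o, 'a, 'z) cat_scheme \<Rightarrow> 'o \<Rightarrow> 'o \<Rightarrow> 'a set" where
  "hom C A B = {f \<in> Arr C. Dom C f = A \<and> Cod C f = B}"

locale category =
  fixes C :: "('o, 'a, 'z) cat_scheme" (structure)
  assumes Dom_Obj: "f \<in> Arr C \<Longrightarrow> Dom C f \<in> Obj C"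
    and Cod_Obj: "f \<in> Arr C \<Longrightarrow> Cod C f \<in> Obj C"
    and Idn_hom: "A \<in> Obj C \<Longrightarrow> Idn C A \<in> hom C A A"
    and Comp_hom: "f \<in> hom C A B \<Longrightarrow> g \<in> hom C B X \<Longrightarrow> f ;; g \<in> hom C A X"
    and Idn_left: "f \<in> hom C A B \<Longrightarrow> Idn C A ;; f = f"
    and Idn_right: "f \<in> hom C A B \<Longrightarrow> f ;; Idn C B = f"
    and Comp_assoc: "f \<in> hom C A B \<Longrightarrow> g \<in> hom C B X \<Longrightarrow> h \<in> hom C X Y
          \<Longrightarrow> (f ;; g) ;; h = f ;; (g ;; h)"

definition inverse_arrows :: "('o, 'a, 'z) cat_scheme \<Rightarrow> 'a \<Rightarrow> 'a \<Rightarrow> bool" where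
  "inverse_arrows C f g \<longleftrightarrow> f \<in> Arr C \<and> g \<in> hom C (Cod C f) (Dom C f)
     \<and> f ;;\<^bsub>C\<^esub> g = Idn C (Dom C f) \<and> g ;;\<^bsub>C\<^esub> f = Idn C (Cod C f)"

definition iso_arrow :: "('o, 'a, 'z) cat_scheme \<Rightarrow> 'a \<Rightarrow> bool" where
  "iso_arrow C f \<longleftrightarrow> (\<exists>g. inverse_arrows C f g)"

definition inv_arrow :: "('o, 'a, 'z) cat_scheme \<Rightarrow> 'a \<Rightarrow> 'a" where
  "inv_arrow C f = (THE g. inverse_arrows C f g)"

record ('o, 'a, 'p, 'b) cfunctor =
  ob :: "'o \<Rightarrow> 'p"
  ar :: "'a \<Rightarrow> 'b"

definition comp_functor ::
  "('o, 'a, 'p, 'b, 'y) cfunctor_scheme \<Rightarrow> ('p, 'b, 'q, 'c, 'z) cfunctor_scheme \<Rightarrow> ('o, 'a, 'q, 'c) cfunctor"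
  where
  "comp_functor F G = \<lparr>ob = (\<lambda>A. ob G (ob F A)), ar = (\<lambda>f. ar G (ar F f))\<rparr>"

locale cat_functor =
  source: category C + target: category D
  for C :: "('o, 'a, 'y) cat_scheme" and D :: "('p, 'b, 'z) cat_scheme" +
  fixes F :: "('o, 'a, 'p, 'b, 'w) cfunctor_scheme"
  assumes ob_Obj: "A \<in> Obj C \<Longrightarrow> ob F A \<in> Obj D"
    and ar_hom: "f \<in> hom C A B \<Longrightarrow> ar F f \<in> hom D (ob F A) (ob F B)"
    and ar_Idn: "A \<in> Obj C \<Longrightarrow> ar F (Idn C A) = Idn D (ob F A)"
    and ar_Comp: "f \<in> hom C A B \<Longrightarrow> g \<in> hom C B X
          \<Longrightarrow> ar F (f ;;\<^bsub>C\<^esub> g) = ar F f ;;\<^bsub>D\<^esub> ar F g"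

locale adjunction =
  left: cat_functor C D L + right: cat_functor D C R
  for C :: "('o, 'a, 'y) cat_scheme" and D :: "('p, 'b, 'z) cat_scheme"
    and L :: "('o, 'a, 'p, 'b) cfunctor" and R :: "('p, 'b, 'o, 'a) cfunctor" +
  fixes \<eta> :: "'o \<Rightarrow> 'a" and \<epsilon> :: "'p \<Rightarrow> 'b"
  assumes unit_hom: "A \<in> Obj C \<Longrightarrow> \<eta> A \<in> hom C A (ob R (ob L A))"
    and unit_natural: "f \<in> hom C A A' \<Longrightarrow> f ;;\<^bsub>C\<^esub> \<eta> A' = \<eta> A ;;\<^bsub>C\<^esub> ar R (ar L f)"
    and counit_hom: "B \<in> Obj D \<Longrightarrow> \<epsilon> B \<in> hom D (ob L (ob R B)) B"
    and counit_natural: "g \<in> hom D B B' \<Longrightarrow> ar L (ar R g) ;;\<^bsub>D\<^esub> \<epsilon> B' = \<epsilon> B ;;\<^bsub>D\<^esub> g"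
    and triangle_L: "A \<in> Obj C \<Longrightarrow> ar L (\<eta> A) ;;\<^bsub>D\<^esub> \<epsilon> (ob L A) = Idn D (ob L A)"
    and triangle_R: "B \<in> Obj D \<Longrightarrow> \<eta> (ob R B) ;;\<^bsub>C\<^esub> ar R (\<epsilon> B) = Idn C (ob R B)"


section \<open>Monoidal and monoidal closed categories\<close>

record ('o, 'a) monoidal_cat = "('o, 'a) cat" +
  tensO :: "'o \<Rightarrow> 'o \<Rightarrow> 'o" (infixr "\<otimes>\<index>" 70)
  tensA :: "'a \<Rightarrow> 'a \<Rightarrow> 'a" (infixr "\<otimes>\<^sub>a\<index>" 70)
  unitO :: "'o" ("\<one>\<index>")
  assoc :: "'o \<Rightarrow> 'o \<Rightarrow> 'o \<Rightarrow> 'a"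
  lunit :: "'o \<Rightarrow> 'a"
  runit :: "'o \<Rightarrow> 'a"

locale monoidal_category = category C
  for C :: "('o, 'a, 'z) monoidal_cat_scheme" (structure) +
  assumes tensO_Obj: "A \<in> Obj C \<Longrightarrow> B \<in> Obj C \<Longrightarrow> A \<otimes> B \<in> Obj C"
    and unitO_Obj: "\<one> \<in> Obj C"
    and tensA_hom: "f \<in> hom C A A' \<Longrightarrow> g \<in> hom C B B' \<Longrightarrow> f \<otimes>\<^sub>a g \<in> hom C (A \<otimes> B) (A' \<otimes> B')"
    and tensA_Idn: "A \<in> Obj C \<Longrightarrow> B \<in> Obj C \<Longrightarrow> Idn C A \<otimes>\<^sub>a Idn C B = Idn C (A \<otimes> B)"
    and tensA_Comp: "f \<in> hom C A A' \<Longrightarrow> f' \<in> hom C A' A'' \<Longrightarrow> g \<in> hom C B B' \<Longrightarrow> g' \<in> hom C B' B''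
          \<Longrightarrow> (f ;; f') \<otimes>\<^sub>a (g ;; g') = (f \<otimes>\<^sub>a g) ;; (f' \<otimes>\<^sub>a g')"
    and assoc_hom: "A \<in> Obj C \<Longrightarrow> B \<in> Obj C \<Longrightarrow> X \<in> Obj C
          \<Longrightarrow> assoc C A B X \<in> hom C ((A \<otimes> B) \<otimes> X) (A \<otimes> (B \<otimes> X))"
    and assoc_iso: "A \<in> Obj C \<Longrightarrow> B \<in> Obj C \<Longrightarrow> X \<in> Obj C \<Longrightarrow> iso_arrow C (assoc C A B X)"
    and assoc_natural: "f \<in> hom C A A' \<Longrightarrow> g \<in> hom C B B' \<Longrightarrow> h \<in> hom C X X'
          \<Longrightarrow> ((f \<otimes>\<^sub>a g) \<otimes>\<^sub>a h) ;; assoc C A' B' X' = assoc C A B X ;; (f \<otimes>\<^sub>a (g \<otimes>\<^sub>a h))"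
    and lunit_hom: "A \<in> Obj C \<Longrightarrow> lunit C A \<in> hom C (\<one> \<otimes> A) A"
    and lunit_iso: "A \<in> Obj C \<Longrightarrow> iso_arrow C (lunit C A)"
    and lunit_natural: "f \<in> hom C A A' \<Longrightarrow> (Idn C \<one> \<otimes>\<^sub>a f) ;; lunit C A' = lunit C A ;; f"
    and runit_hom: "A \<in> Obj C \<Longrightarrow> runit C A \<in> hom C (A \<otimes> \<one>) A"
    and runit_iso: "A \<in> Obj C \<Longrightarrow> iso_arrow C (runit C A)"
    and runit_natural: "f \<in> hom C A A' \<Longrightarrow> (f \<otimes>\<^sub>a Idn C \<one>) ;; runit C A' = runit C A ;; f"
    and pentagon: "A \<in> Obj C \<Longrightarrow> B \<in> Obj C \<Longrightarrow> X \<in> Obj C \<Longrightarrow> Y \<in> Obj C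
          \<Longrightarrow> (assoc C A B X \<otimes>\<^sub>a Idn C Y) ;; assoc C A (B \<otimes> X) Y ;; (Idn C A \<otimes>\<^sub>a assoc C B X Y)
              = assoc C (A \<otimes> B) X Y ;; assoc C A B (X \<otimes> Y)"
    and triangle: "A \<in> Obj C \<Longrightarrow> B \<in> Obj C
          \<Longrightarrow> assoc C A \<one> B ;; (Idn C A \<otimes>\<^sub>a lunit C B) = runit C A \<otimes>\<^sub>a Idn C B"

text \<open>
  \<open>lres C A X\<close> is the left residual \<open>A \ X\<close> and \<open>rres C X B\<close> the right residual \<open>X / B\<close>.
  For \<open>f : A \<otimes> X \<rightarrow> Y\<close>, the transpose is \<open>lam C A X f\<close>; for \<open>f : X \<otimes> B \<rightarrow> Y\<close>, it is
  \<open>rho C X B f\<close>. The factors of the domain are explicit arguments because they cannot be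
  recovered from \<open>f\<close>. The two equations for each transpose make it a bijection, natural in \<open>X\<close>.
\<close>

record ('o, 'a) closed_cat = "('o, 'a) monoidal_cat" +
  lres :: "'o \<Rightarrow> 'o \<Rightarrow> 'o"
  evl :: "'o \<Rightarrow> 'o \<Rightarrow> 'a"
  lam :: "'o \<Rightarrow> 'o \<Rightarrow> 'a \<Rightarrow> 'a"
  rres :: "'o \<Rightarrow> 'o \<Rightarrow> 'o"
  evr :: "'o \<Rightarrow> 'o \<Rightarrow> 'a"
  rho :: "'o \<Rightarrow> 'o \<Rightarrow> 'a \<Rightarrow> 'a"

locale monoidal_closed_category = monoidal_category C
  for C :: "('o, 'a, 'z) closed_cat_scheme" (structure) +
  assumes lres_Obj: "A \<in> Obj C \<Longrightarrow> Y \<in> Obj C \<Longrightarrow> lres C A Y \<in> Obj C"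
    and evl_hom: "A \<in> Obj C \<Longrightarrow> Y \<in> Obj C \<Longrightarrow> evl C A Y \<in> hom C (A \<otimes> lres C A Y) Y"
    and lam_hom: "A \<in> Obj C \<Longrightarrow> X \<in> Obj C \<Longrightarrow> Y \<in> Obj C \<Longrightarrow> f \<in> hom C (A \<otimes> X) Y
          \<Longrightarrow> lam C A X f \<in> hom C X (lres C A Y)"
    and lam_evl: "A \<in> Obj C \<Longrightarrow> X \<in> Obj C \<Longrightarrow> Y \<in> Obj C \<Longrightarrow> f \<in> hom C (A \<otimes> X) Y
          \<Longrightarrow> (Idn C A \<otimes>\<^sub>a lam C A X f) ;; evl C A Y = f"
    and lam_unique: "A \<in> Obj C \<Longrightarrow> X \<in> Obj C \<Longrightarrow> Y \<in> Obj C \<Longrightarrow> g \<in> hom C X (lres C A Y)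
          \<Longrightarrow> lam C A X ((Idn C A \<otimes>\<^sub>a g) ;; evl C A Y) = g"
    and rres_Obj: "Y \<in> Obj C \<Longrightarrow> B \<in> Obj C \<Longrightarrow> rres C Y B \<in> Obj C"
    and evr_hom: "Y \<in> Obj C \<Longrightarrow> B \<in> Obj C \<Longrightarrow> evr C Y B \<in> hom C (rres C Y B \<otimes> B) Y"
    and rho_hom: "X \<in> Obj C \<Longrightarrow> B \<in> Obj C \<Longrightarrow> Y \<in> Obj C \<Longrightarrow> f \<in> hom C (X \<otimes> B) Y
          \<Longrightarrow> rho C X B f \<in> hom C X (rres C Y B)"
    and rho_evr: "X \<in> Obj C \<Longrightarrow> B \<in> Obj C \<Longrightarrow> Y \<in> Obj C \<Longrightarrow> f \<in> hom C (X \<otimes> B) Y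
          \<Longrightarrow> (rho C X B f \<otimes>\<^sub>a Idn C B) ;; evr C Y B = f"
    and rho_unique: "X \<in> Obj C \<Longrightarrow> B \<in> Obj C \<Longrightarrow> Y \<in> Obj C \<Longrightarrow> g \<in> hom C X (rres C Y B)
          \<Longrightarrow> rho C X B ((g \<otimes>\<^sub>a Idn C B) ;; evr C Y B) = g"

definition shift :: "('o, 'a, 'z) closed_cat_scheme \<Rightarrow> 'o \<Rightarrow> 'o \<Rightarrow> 'a" where
  "shift C B Y = lam C (rres C Y B) B (evr C Y B)"

record ('o, 'a, 'p, 'b) monoidal_functor = "('o, 'a, 'p, 'b) cfunctor" +
  tens_cmp :: "'o \<Rightarrow> 'o \<Rightarrow> 'b"
  unit_cmp :: "'b"

locale strong_monoidal_functor =
  source: monoidal_category C + target: monoidal_category D + cat_functor C D F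
  for C :: "('o, 'a, 'y) monoidal_cat_scheme" and D :: "('p, 'b, 'z) monoidal_cat_scheme"
    and F :: "('o, 'a, 'p, 'b) monoidal_functor" +
  assumes tens_cmp_hom: "A \<in> Obj C \<Longrightarrow> B \<in> Obj C
          \<Longrightarrow> tens_cmp F A B \<in> hom D (ob F A \<otimes>\<^bsub>D\<^esub> ob F B) (ob F (A \<otimes>\<^bsub>C\<^esub> B))"
    and tens_cmp_iso: "A \<in> Obj C \<Longrightarrow> B \<in> Obj C \<Longrightarrow> iso_arrow D (tens_cmp F A B)"
    and tens_cmp_natural: "f \<in> hom C A A' \<Longrightarrow> g \<in> hom C B B'
          \<Longrightarrow> (ar F f \<otimes>\<^sub>a\<^bsub>D\<^esub> ar F g) ;;\<^bsub>D\<^esub> tens_cmp F A' B' = tens_cmp F A B ;;\<^bsub>D\<^esub> ar F (f \<otimes>\<^sub>a\<^bsub>C\<^esub> g)"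
    and unit_cmp_hom: "unit_cmp F \<in> hom D \<one>\<^bsub>D\<^esub> (ob F \<one>\<^bsub>C\<^esub>)"
    and unit_cmp_iso: "iso_arrow D (unit_cmp F)"
    and cmp_assoc: "A \<in> Obj C \<Longrightarrow> B \<in> Obj C \<Longrightarrow> X \<in> Obj C
          \<Longrightarrow> (tens_cmp F A B \<otimes>\<^sub>a\<^bsub>D\<^esub> Idn D (ob F X)) ;;\<^bsub>D\<^esub> tens_cmp F (A \<otimes>\<^bsub>C\<^esub> B) X
                ;;\<^bsub>D\<^esub> ar F (assoc C A B X)
              = assoc D (ob F A) (ob F B) (ob F X) ;;\<^bsub>D\<^esub> (Idn D (ob F A) \<otimes>\<^sub>a\<^bsub>D\<^esub> tens_cmp F B X)
                ;;\<^bsub>D\<^esub> tens_cmp F A (B \<otimes>\<^bsub>C\<^esub> X)"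
    and cmp_lunit: "A \<in> Obj C
          \<Longrightarrow> (unit_cmp F \<otimes>\<^sub>a\<^bsub>D\<^esub> Idn D (ob F A)) ;;\<^bsub>D\<^esub> tens_cmp F \<one>\<^bsub>C\<^esub> A ;;\<^bsub>D\<^esub> ar F (lunit C A)
              = lunit D (ob F A)"
    and cmp_runit: "A \<in> Obj C
          \<Longrightarrow> (Idn D (ob F A) \<otimes>\<^sub>a\<^bsub>D\<^esub> unit_cmp F) ;;\<^bsub>D\<^esub> tens_cmp F A \<one>\<^bsub>C\<^esub> ;;\<^bsub>D\<^esub> ar F (runit C A)
              = runit D (ob F A)"

locale monad_strength = monoidal_category C + cat_functor C C M
  for C :: "('o, 'a, 'z) monoidal_cat_scheme" (structure)
    and M :: "('o, 'a, 'o, 'a) cfunctor" +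
  fixes \<eta> :: "'o \<Rightarrow> 'a" and \<mu> :: "'o \<Rightarrow> 'a" and \<sigma> :: "'o \<Rightarrow> 'o \<Rightarrow> 'a"
  assumes strength_hom: "A \<in> Obj C \<Longrightarrow> B \<in> Obj C \<Longrightarrow> \<sigma> A B \<in> hom C (A \<otimes> ob M B) (ob M (A \<otimes> B))"
    and strength_natural: "f \<in> hom C A A' \<Longrightarrow> g \<in> hom C B B'
          \<Longrightarrow> (f \<otimes>\<^sub>a ar M g) ;; \<sigma> A' B' = \<sigma> A B ;; ar M (f \<otimes>\<^sub>a g)"
    and strength_lunit: "A \<in> Obj C \<Longrightarrow> \<sigma> \<one> A ;; ar M (lunit C A) = lunit C (ob M A)"
    and strength_assoc: "A \<in> Obj C \<Longrightarrow> B \<in> Obj C \<Longrightarrow> X \<in> Obj C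
          \<Longrightarrow> assoc C A B (ob M X) ;; (Idn C A \<otimes>\<^sub>a \<sigma> B X) ;; \<sigma> A (B \<otimes> X)
              = \<sigma> (A \<otimes> B) X ;; ar M (assoc C A B X)"
    and strength_unit: "A \<in> Obj C \<Longrightarrow> B \<in> Obj C \<Longrightarrow> (Idn C A \<otimes>\<^sub>a \<eta> B) ;; \<sigma> A B = \<eta> (A \<otimes> B)"
    and strength_mult: "A \<in> Obj C \<Longrightarrow> B \<in> Obj C
          \<Longrightarrow> (Idn C A \<otimes>\<^sub>a \<mu> B) ;; \<sigma> A B = \<sigma> A (ob M B) ;; ar M (\<sigma> A B) ;; \<mu> (A \<otimes> B)"


section \<open>Type refinement systems\<close>

locale refinement_system = cat_functor E I p
  for E :: "('eo, 'ea, 'y) cat_scheme" and I :: "('io, 'ia, 'z) cat_scheme"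
    and p :: "('eo, 'ea, 'io, 'ia, 'w) cfunctor_scheme"

definition refines ::
  "('eo, 'ea, 'y) cat_scheme \<Rightarrow> ('eo, 'ea, 'io, 'ia, 'w) cfunctor_scheme \<Rightarrow> 'eo \<Rightarrow> 'io \<Rightarrow> bool" where
  "refines E p S A \<longleftrightarrow> S \<in> Obj E \<and> ob p S = A"

definition derivation ::
  "('eo, 'ea, 'y) cat_scheme \<Rightarrow> ('eo, 'ea, 'io, 'ia, 'w) cfunctor_scheme
    \<Rightarrow> 'eo \<Rightarrow> 'ia \<Rightarrow> 'eo \<Rightarrow> 'ea \<Rightarrow> bool" where
  "derivation E p S f T \<alpha> \<longleftrightarrow> \<alpha> \<in> hom E S T \<and> ar p \<alpha> = f"

definition vertical_iso ::
  "('eo, 'ea, 'y) cat_scheme \<Rightarrow> ('io, 'ia, 'z) cat_scheme \<Rightarrow> ('eo, 'ea, 'io, 'ia, 'w) cfunctor_scheme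
    \<Rightarrow> 'eo \<Rightarrow> 'eo \<Rightarrow> 'ea \<Rightarrow> bool" where
  "vertical_iso E I p S T \<alpha> \<longleftrightarrow>
     (\<exists>A. refines E p S A \<and> refines E p T A \<and> derivation E p S (Idn I A) T \<alpha> \<and>
       (\<exists>\<beta>. derivation E p T (Idn I A) S \<beta> \<and> \<alpha> ;;\<^bsub>E\<^esub> \<beta> = Idn E S \<and> \<beta> ;;\<^bsub>E\<^esub> \<alpha> = Idn E T))"

definition vertically_isomorphic ::
  "('eo, 'ea, 'y) cat_scheme \<Rightarrow> ('io, 'ia, 'z) cat_scheme \<Rightarrow> ('eo, 'ea, 'io, 'ia, 'w) cfunctor_scheme
    \<Rightarrow> 'eo \<Rightarrow> 'eo \<Rightarrow> bool" where
  "vertically_isomorphic E I p S T \<longleftrightarrow> (\<exists>\<alpha>. vertical_iso E I p S T \<alpha>)"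

text \<open>
  \<open>R g \<beta>\<close> is the factorisation of a derivation \<open>\<beta>\<close> of \<open>S \<Rightarrow> T\<close> over \<open>g ;; f\<close>; \<open>g\<close> is an
  argument because it cannot be recovered from \<open>\<beta>\<close>.
\<close>

definition pullback_structure ::
  "('eo, 'ea, 'y) cat_scheme \<Rightarrow> ('io, 'ia, 'z) cat_scheme \<Rightarrow> ('eo, 'ea, 'io, 'ia, 'w) cfunctor_scheme
    \<Rightarrow> 'ia \<Rightarrow> 'eo \<Rightarrow> 'eo \<Rightarrow> 'ea \<Rightarrow> ('ia \<Rightarrow> 'ea \<Rightarrow> 'ea) \<Rightarrow> bool" where
  "pullback_structure E I p f T P l R \<longleftrightarrow>
     f \<in> Arr I \<and> refines E p T (Cod I f) \<and> refines E p P (Dom I f) \<and> derivation E p P f T l \<and>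
     (\<forall>S g. S \<in> Obj E \<longrightarrow> g \<in> hom I (ob p S) (Dom I f) \<longrightarrow>
        (\<forall>\<beta>. derivation E p S (g ;;\<^bsub>I\<^esub> f) T \<beta> \<longrightarrow>
              derivation E p S g P (R g \<beta>) \<and> R g \<beta> ;;\<^bsub>E\<^esub> l = \<beta>) \<and>
        (\<forall>\<eta>. derivation E p S g P \<eta> \<longrightarrow> R g (\<eta> ;;\<^bsub>E\<^esub> l) = \<eta>))"

definition exhibits_pullback ::
  "('eo, 'ea, 'y) cat_scheme \<Rightarrow> ('io, 'ia, 'z) cat_scheme \<Rightarrow> ('eo, 'ea, 'io, 'ia, 'w) cfunctor_scheme
    \<Rightarrow> 'eo \<Rightarrow> 'ia \<Rightarrow> 'eo \<Rightarrow> 'ea \<Rightarrow> bool" where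
  "exhibits_pullback E I p S f T l \<longleftrightarrow> (\<exists>R. pullback_structure E I p f T S l R)"

definition is_pullback ::
  "('eo, 'ea, 'y) cat_scheme \<Rightarrow> ('io, 'ia, 'z) cat_scheme \<Rightarrow> ('eo, 'ea, 'io, 'ia, 'w) cfunctor_scheme
    \<Rightarrow> 'eo \<Rightarrow> 'ia \<Rightarrow> 'eo \<Rightarrow> bool" where
  "is_pullback E I p S f T \<longleftrightarrow> (\<exists>l. exhibits_pullback E I p S f T l)"

text \<open>An arbitrary choice of pullbacks, written \<open>f\<^sup>*T\<close> informally and \<open>pb K f T\<close> here.\<close>

record ('eo, 'ea, 'ia) cleavage =
  pb :: "'ia \<Rightarrow> 'eo \<Rightarrow> 'eo"
  pb_der :: "'ia \<Rightarrow> 'eo \<Rightarrow> 'ea"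
  pb_fac :: "'ia \<Rightarrow> 'eo \<Rightarrow> 'ia \<Rightarrow> 'ea \<Rightarrow> 'ea"

locale fibration = refinement_system E I p
  for E :: "('eo, 'ea, 'y) cat_scheme" and I :: "('io, 'ia, 'z) cat_scheme"
    and p :: "('eo, 'ea, 'io, 'ia, 'w) cfunctor_scheme" +
  fixes K :: "('eo, 'ea, 'ia) cleavage"
  assumes has_pullbacks: "f \<in> hom I A B \<Longrightarrow> refines E p T B
          \<Longrightarrow> pullback_structure E I p f T (pb K f T) (pb_der K f T) (pb_fac K f T)"


section \<open>Monoidal closed type refinement systems\<close>

text \<open>
  The typing rules for \<open>\<otimes>\<close> force \<open>p\<close> to preserve \<open>\<otimes>\<close> on the nose on objects and arrows, and the
  unit on the nose. The comparison isomorphisms of the strong monoidal functor \<open>p\<close> are not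
  required to be identities.
\<close>

locale monoidal_refinement_system = strong_monoidal_functor E I p
  for E :: "('eo, 'ea, 'y) monoidal_cat_scheme" and I :: "('io, 'ia, 'z) monoidal_cat_scheme"
    and p :: "('eo, 'ea, 'io, 'ia) monoidal_functor" +
  assumes tens_refines: "refines E p S A \<Longrightarrow> refines E p T B
          \<Longrightarrow> refines E p (S \<otimes>\<^bsub>E\<^esub> T) (A \<otimes>\<^bsub>I\<^esub> B)"
    and unit_refines: "refines E p \<one>\<^bsub>E\<^esub> \<one>\<^bsub>I\<^esub>"
    and tens_derivation: "derivation E p S f S' \<alpha> \<Longrightarrow> derivation E p T g T' \<beta>
          \<Longrightarrow> derivation E p (S \<otimes>\<^bsub>E\<^esub> T) (f \<otimes>\<^sub>a\<^bsub>I\<^esub> g) (S' \<otimes>\<^bsub>E\<^esub> T') (\<alpha> \<otimes>\<^sub>a\<^bsub>E\<^esub> \<beta>)"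

locale monoidal_closed_refinement_system =
  monoidal_refinement_system E I p + base: monoidal_closed_category I
  for E :: "('eo, 'ea) closed_cat" and I :: "('io, 'ia) closed_cat"
    and p :: "('eo, 'ea, 'io, 'ia) monoidal_functor" +
  assumes lres_refines: "refines E p S A \<Longrightarrow> refines E p U Y
          \<Longrightarrow> refines E p (lres E S U) (lres I A Y)"
    and evl_derivation: "refines E p S A \<Longrightarrow> refines E p U Y
          \<Longrightarrow> derivation E p (S \<otimes>\<^bsub>E\<^esub> lres E S U) (evl I A Y) U (evl E S U)"
    and lam_derivation: "refines E p S A \<Longrightarrow> refines E p X B \<Longrightarrow> refines E p U Y
          \<Longrightarrow> derivation E p (S \<otimes>\<^bsub>E\<^esub> X) f U \<beta>
          \<Longrightarrow> derivation E p X (lam I A B f) (lres E S U) (lam E S X \<beta>)"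
    and lam_evl_derivation: "S \<in> Obj E \<Longrightarrow> X \<in> Obj E \<Longrightarrow> U \<in> Obj E \<Longrightarrow> \<beta> \<in> hom E (S \<otimes>\<^bsub>E\<^esub> X) U
          \<Longrightarrow> (Idn E S \<otimes>\<^sub>a\<^bsub>E\<^esub> lam E S X \<beta>) ;;\<^bsub>E\<^esub> evl E S U = \<beta>"
    and lam_unique_derivation: "S \<in> Obj E \<Longrightarrow> X \<in> Obj E \<Longrightarrow> U \<in> Obj E \<Longrightarrow> \<eta> \<in> hom E X (lres E S U)
          \<Longrightarrow> lam E S X ((Idn E S \<otimes>\<^sub>a\<^bsub>E\<^esub> \<eta>) ;;\<^bsub>E\<^esub> evl E S U) = \<eta>"
    and rres_refines: "refines E p U Y \<Longrightarrow> refines E p T B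
          \<Longrightarrow> refines E p (rres E U T) (rres I Y B)"
    and evr_derivation: "refines E p U Y \<Longrightarrow> refines E p T B
          \<Longrightarrow> derivation E p (rres E U T \<otimes>\<^bsub>E\<^esub> T) (evr I Y B) U (evr E U T)"
    and rho_derivation: "refines E p X A \<Longrightarrow> refines E p T B \<Longrightarrow> refines E p U Y
          \<Longrightarrow> derivation E p (X \<otimes>\<^bsub>E\<^esub> T) f U \<beta>
          \<Longrightarrow> derivation E p X (rho I A B f) (rres E U T) (rho E X T \<beta>)"
    and rho_evr_derivation: "X \<in> Obj E \<Longrightarrow> T \<in> Obj E \<Longrightarrow> U \<in> Obj E \<Longrightarrow> \<beta> \<in> hom E (X \<otimes>\<^bsub>E\<^esub> T) U
          \<Longrightarrow> (rho E X T \<beta> \<otimes>\<^sub>a\<^bsub>E\<^esub> Idn E T) ;;\<^bsub>E\<^esub> evr E U T = \<beta>"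
    and rho_unique_derivation: "X \<in> Obj E \<Longrightarrow> T \<in> Obj E \<Longrightarrow> U \<in> Obj E \<Longrightarrow> \<eta> \<in> hom E X (rres E U T)
          \<Longrightarrow> rho E X T ((\<eta> \<otimes>\<^sub>a\<^bsub>E\<^esub> Idn E T) ;;\<^bsub>E\<^esub> evr E U T) = \<eta>"

locale monoidal_closed_fibration =
  monoidal_closed_refinement_system E I p + fibration E I p K
  for E :: "('eo, 'ea) closed_cat" and I :: "('io, 'ia) closed_cat"
    and p :: "('eo, 'ea, 'io, 'ia) monoidal_functor"
    and K :: "('eo, 'ea, 'ia) cleavage" +
  assumes tens_preserves_pullbacks:
    "f1 \<in> hom I A1 B1 \<Longrightarrow> refines E p T1 B1 \<Longrightarrow> f2 \<in> hom I A2 B2 \<Longrightarrow> refines E p T2 B2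
      \<Longrightarrow> vertical_iso E I p (pb K f1 T1 \<otimes>\<^bsub>E\<^esub> pb K f2 T2) (pb K (f1 \<otimes>\<^sub>a\<^bsub>I\<^esub> f2) (T1 \<otimes>\<^bsub>E\<^esub> T2))
            (pb_fac K (f1 \<otimes>\<^sub>a\<^bsub>I\<^esub> f2) (T1 \<otimes>\<^bsub>E\<^esub> T2) (Idn I (A1 \<otimes>\<^bsub>I\<^esub> A2))
              (pb_der K f1 T1 \<otimes>\<^sub>a\<^bsub>E\<^esub> pb_der K f2 T2))"


section \<open>Adjunctions of type refinement systems and universal types\<close>

locale refinement_adjunction =
  p: refinement_system E I p + q: refinement_system D J q +
  base: adjunction I J L0 R0 \<eta>0 \<epsilon>0 + total: adjunction E D L1 R1 \<eta>1 \<epsilon>1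
  for E :: "('eo, 'ea, 'x) cat_scheme" and I :: "('io, 'ia, 'y) cat_scheme"
    and p :: "('eo, 'ea, 'io, 'ia, 'v) cfunctor_scheme"
    and D :: "('do, 'da, 'z) cat_scheme" and J :: "('jo, 'ja, 'u) cat_scheme"
    and q :: "('do, 'da, 'jo, 'ja, 'w) cfunctor_scheme"
    and L0 R0 \<eta>0 \<epsilon>0 L1 R1 \<eta>1 \<epsilon>1 +
  assumes q_L1_ob: "S \<in> Obj E \<Longrightarrow> ob q (ob L1 S) = ob L0 (ob p S)"
    and q_L1_ar: "\<alpha> \<in> Arr E \<Longrightarrow> ar q (ar L1 \<alpha>) = ar L0 (ar p \<alpha>)"
    and p_R1_ob: "T \<in> Obj D \<Longrightarrow> ob p (ob R1 T) = ob R0 (ob q T)"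
    and p_R1_ar: "\<beta> \<in> Arr D \<Longrightarrow> ar p (ar R1 \<beta>) = ar R0 (ar q \<beta>)"
    and p_unit: "S \<in> Obj E \<Longrightarrow> ar p (\<eta>1 S) = \<eta>0 (ob p S)"
    and q_counit: "T \<in> Obj D \<Longrightarrow> ar q (\<epsilon>1 T) = \<epsilon>0 (ob q T)"

definition gives_strong_monad ::
  "('eo, 'ea, 'y) monoidal_cat_scheme \<Rightarrow> ('io, 'ia, 'z) monoidal_cat_scheme
    \<Rightarrow> ('eo, 'ea, 'io, 'ia, 'w) cfunctor_scheme
    \<Rightarrow> ('io, 'ia, 'jo, 'ja) cfunctor \<Rightarrow> ('jo, 'ja, 'io, 'ia) cfunctor \<Rightarrow> ('io \<Rightarrow> 'ia) \<Rightarrow> ('jo \<Rightarrow> 'ja)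
    \<Rightarrow> ('eo, 'ea, 'do, 'da) cfunctor \<Rightarrow> ('do, 'da, 'eo, 'ea) cfunctor \<Rightarrow> ('eo \<Rightarrow> 'ea) \<Rightarrow> ('do \<Rightarrow> 'da)
    \<Rightarrow> bool" where
  "gives_strong_monad E I p L0 R0 \<eta>0 \<epsilon>0 L1 R1 \<eta>1 \<epsilon>1 \<longleftrightarrow>
     (\<exists>\<sigma>0 \<sigma>1.
        monad_strength I (comp_functor L0 R0) \<eta>0 (\<lambda>A. ar R0 (\<epsilon>0 (ob L0 A))) \<sigma>0 \<and>
        monad_strength E (comp_functor L1 R1) \<eta>1 (\<lambda>S. ar R1 (\<epsilon>1 (ob L1 S))) \<sigma>1 \<and>
        (\<forall>S\<in>Obj E. \<forall>T\<in>Obj E. ar p (\<sigma>1 S T) = \<sigma>0 (ob p S) (ob p T)))"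

definition encoding ::
  "('do, 'da, 'z) cat_scheme \<Rightarrow> ('jo, 'ja, 'u) cat_scheme \<Rightarrow> ('do, 'da, 'jo, 'ja, 'w) cfunctor_scheme
    \<Rightarrow> 'do \<Rightarrow> 'do \<Rightarrow> 'ja \<Rightarrow> bool" where
  "encoding D J q S U e \<longleftrightarrow> e \<in> hom J (ob q S) (ob q U) \<and> is_pullback D J q S e U"

definition universal_type ::
  "('do, 'da, 'z) cat_scheme \<Rightarrow> ('jo, 'ja, 'u) cat_scheme \<Rightarrow> ('do, 'da, 'jo, 'ja, 'w) cfunctor_scheme
    \<Rightarrow> 'do \<Rightarrow> ('do \<Rightarrow> 'ja) \<Rightarrow> bool" where
  "universal_type D J q U e \<longleftrightarrow> U \<in> Obj D \<and> (\<forall>S\<in>Obj D. encoding D J q S U (e S))"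

definition preserves_pullbacks ::
  "('do, 'da, 'z) cat_scheme \<Rightarrow> ('jo, 'ja, 'u) cat_scheme \<Rightarrow> ('do, 'da, 'jo, 'ja, 'w) cfunctor_scheme
    \<Rightarrow> ('eo, 'ea, 'x) cat_scheme \<Rightarrow> ('io, 'ia, 'y) cat_scheme \<Rightarrow> ('eo, 'ea, 'io, 'ia, 'v) cfunctor_scheme
    \<Rightarrow> ('jo, 'ja, 'io, 'ia) cfunctor \<Rightarrow> ('do, 'da, 'eo, 'ea) cfunctor \<Rightarrow> bool" where
  "preserves_pullbacks D J q E I p R0 R1 \<longleftrightarrow>
     (\<forall>S f T \<alpha>. exhibits_pullback D J q S f T \<alpha>
        \<longrightarrow> exhibits_pullback E I p (ob R1 S) (ar R0 f) (ob R1 T) (ar R1 \<alpha>))"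

text \<open>
  For \<open>k : B \<rightarrow> Y\<close>, the expression \<open>eval_at I B Y k\<close> is
  \<open>(Y/B)\Y \<cong> \<one> \<otimes> ((Y/B)\Y) \<rightarrow> (Y/B) \<otimes> ((Y/B)\Y) \<rightarrow> Y\<close>, where the middle map is
  \<open>\<rho>(k) \<otimes> id\<close> with \<open>k\<close> read as a map \<open>\<one> \<otimes> B \<rightarrow> Y\<close>.
\<close>

definition eval_at :: "('io, 'ia, 'z) closed_cat_scheme \<Rightarrow> 'io \<Rightarrow> 'io \<Rightarrow> 'ia \<Rightarrow> 'ia" where
  "eval_at I B Y k =
     (let Z = lres I (rres I Y B) Y in
      inv_arrow I (lunit I Z)
        ;;\<^bsub>I\<^esub> (rho I \<one>\<^bsub>I\<^esub> B (lunit I B ;;\<^bsub>I\<^esub> k) \<otimes>\<^sub>a\<^bsub>I\<^esub> Idn I Z)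
        ;;\<^bsub>I\<^esub> evl I (rres I Y B) Y)"

definition reflected ::
  "('eo, 'ea) closed_cat \<Rightarrow> ('io, 'ia) closed_cat \<Rightarrow> ('eo, 'ea, 'io, 'ia) monoidal_functor
    \<Rightarrow> ('do, 'da, 'z) cat_scheme \<Rightarrow> ('jo, 'ja, 'u) cat_scheme \<Rightarrow> ('do, 'da, 'jo, 'ja, 'w) cfunctor_scheme
    \<Rightarrow> ('jo, 'ja, 'io, 'ia) cfunctor \<Rightarrow> ('io \<Rightarrow> 'ia)
    \<Rightarrow> ('eo, 'ea, 'do, 'da) cfunctor \<Rightarrow> ('do, 'da, 'eo, 'ea) cfunctor
    \<Rightarrow> 'do \<Rightarrow> ('do \<Rightarrow> 'ja) \<Rightarrow> bool" where
  "reflected E I p D J q R0 \<eta>0 L1 R1 U e \<longleftrightarrow>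
     preserves_pullbacks D J q E I p R0 R1 \<and>
     (\<forall>T B. refines E p T B \<longrightarrow>
        is_pullback E I p
          (lres E (rres E (ob R1 U) T) (ob R1 U))
          (eval_at I B (ob R0 (ob q U)) (\<eta>0 B ;;\<^bsub>I\<^esub> ar R0 (e (ob L1 T))))
          (ob R1 U))"

end

theory Submission
  imports Defs
begin

text \<open>
  Both sides are pullbacks of the single e-type \<open>R1 U\<close> along the same expression. Let
  \<open>k = \<eta>_B ; R0 e_{L1 T} : B \<rightarrow> R0 C\<close>. Since \<open>R\<close> preserves pullbacks, \<open>R1 L1 T\<close> is the pullback of
  \<open>R1 U\<close> along \<open>R0 e_{L1 T}\<close>, so pulling it back further along \<open>\<eta>_B\<close> gives the pullback along \<open>k\<close>.
  The reflection hypothesis turns the right-hand side into the pullback along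
  \<open>shift ; eval_at k\<close>, and the triangle laws of the residuals give \<open>shift ; eval_at k = k\<close>.
\<close>

section \<open>Inverses of isomorphisms\<close>

lemma homD:
  assumes "f \<in> hom C A B"
  shows "f \<in> Arr C" "Dom C f = A" "Cod C f = B"
  using assms by (auto simp: hom_def)

lemma (in category) inverse_arrows_unique:
  assumes "inverse_arrows C f g" "inverse_arrows C f g'"
  shows "g = g'"
proof -
  have f: "f \<in> hom C (Dom C f) (Cod C f)"
    using assms by (simp add: inverse_arrows_def hom_def)
  have g: "g \<in> hom C (Cod C f) (Dom C f)" "g' \<in> hom C (Cod C f) (Dom C f)"
    and inv: "g ;; f = Idn C (Cod C f)" "f ;; g' = Idn C (Dom C f)"
    using assms by (auto simp: inverse_arrows_def)
  have "g = g ;; (f ;; g')"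
    using Idn_right[OF g(1)] inv by simp
  also have "\<dots> = (g ;; f) ;; g'"
    using Comp_assoc[OF g(1) f g(2)] by simp
  also have "\<dots> = g'"
    using Idn_left[OF g(2)] inv by simp
  finally show ?thesis .
qed

text \<open>\<open>inv_arrow\<close> is a definite description, so it obeys the inverse laws only
  once existence is joined by uniqueness of inverses.\<close>

lemma (in category) inverse_arrows_inv_arrow:
  assumes "iso_arrow C f"
  shows "inverse_arrows C f (inv_arrow C f)"
  using assms unfolding iso_arrow_def inv_arrow_def
  by (metis inverse_arrows_unique theI)

lemma (in category) inv_arrow_hom:
  assumes "iso_arrow C f" "f \<in> hom C A B"
  shows "inv_arrow C f \<in> hom C B A"
  using inverse_arrows_inv_arrow[OF assms(1)] homD[OF assms(2)] by (simp add: inverse_arrows_def)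

lemma (in category) inv_arrow_left:
  assumes "iso_arrow C f" "f \<in> hom C A B"
  shows "inv_arrow C f ;; f = Idn C B"
  using inverse_arrows_inv_arrow[OF assms(1)] homD[OF assms(2)] by (simp add: inverse_arrows_def)

lemma (in category) inv_arrow_right:
  assumes "iso_arrow C f" "f \<in> hom C A B"
  shows "f ;; inv_arrow C f = Idn C A"
  using inverse_arrows_inv_arrow[OF assms(1)] homD[OF assms(2)] by (simp add: inverse_arrows_def)

section \<open>Naturality and interchange in a monoidal category\<close>

lemma (in monoidal_category) inv_lunit_natural:
  assumes f: "f \<in> hom C A B" and A: "A \<in> Obj C" and B: "B \<in> Obj C"
  shows "f ;; inv_arrow C (lunit C B) = inv_arrow C (lunit C A) ;; (Idn C \<one> \<otimes>\<^sub>a f)"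
proof -
  note l = lunit_hom[OF A] lunit_hom[OF B]
  note i = inv_arrow_hom[OF lunit_iso[OF A] l(1)] inv_arrow_hom[OF lunit_iso[OF B] l(2)]
  have t: "Idn C \<one> \<otimes>\<^sub>a f \<in> hom C (\<one> \<otimes> A) (\<one> \<otimes> B)"
    using tensA_hom[OF Idn_hom[OF unitO_Obj] f] .
  \<comment> \<open>Inserting the unitor at \<open>A\<close> and its inverse in front exposes the
    naturality square of \<open>lunit\<close>; the unitor at \<open>B\<close> then cancels.\<close>
  have "f ;; inv_arrow C (lunit C B)
      = (inv_arrow C (lunit C A) ;; lunit C A) ;; (f ;; inv_arrow C (lunit C B))"
    using Idn_left[OF Comp_hom[OF f i(2)]] inv_arrow_left[OF lunit_iso[OF A] l(1)] by simp
  also have "\<dots> = inv_arrow C (lunit C A) ;; ((lunit C A ;; f) ;; inv_arrow C (lunit C B))"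
    using Comp_assoc[OF i(1) l(1) Comp_hom[OF f i(2)]] Comp_assoc[OF l(1) f i(2)] by simp
  also have "(lunit C A ;; f) ;; inv_arrow C (lunit C B)
      = (Idn C \<one> \<otimes>\<^sub>a f) ;; (lunit C B ;; inv_arrow C (lunit C B))"
    using lunit_natural[OF f] Comp_assoc[OF t l(2) i(2)] by simp
  also have "\<dots> = Idn C \<one> \<otimes>\<^sub>a f"
    using inv_arrow_right[OF lunit_iso[OF B] l(2)] Idn_right[OF t] by simp
  finally show ?thesis .
qed

text \<open>Both composites equal \<open>f \<otimes>\<^sub>a g\<close> by functoriality of the
  tensor.\<close>

lemma (in monoidal_category) tensA_interchange:
  assumes f: "f \<in> hom C A A'" and g: "g \<in> hom C B B'"
    and obj: "A \<in> Obj C" "A' \<in> Obj C" "B \<in> Obj C" "B' \<in> Obj C"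
  shows "(Idn C A \<otimes>\<^sub>a g) ;; (f \<otimes>\<^sub>a Idn C B') = (f \<otimes>\<^sub>a Idn C B) ;; (Idn C A' \<otimes>\<^sub>a g)"
  using tensA_Comp[OF Idn_hom f g Idn_hom] tensA_Comp[OF f Idn_hom Idn_hom g] obj
    Idn_left[OF f] Idn_right[OF f] Idn_left[OF g] Idn_right[OF g]
  by simp

section \<open>Shift followed by evaluation at a map\<close>

lemma (in monoidal_closed_category) shift_hom:
  assumes "B \<in> Obj C" "Y \<in> Obj C"
  shows "shift C B Y \<in> hom C B (lres C (rres C Y B) Y)"
  unfolding shift_def using assms by (intro lam_hom rres_Obj evr_hom)

text \<open>Think of \<open>shift\<close> as sending b to "evaluate at b", and of
  \<open>eval_at\<close> as supplying \<open>k\<close> as the function to be evaluated; the result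
  is \<open>k\<close> at b. Formally, \<open>shift\<close> is slid through the inverse unitor and
  past \<open>rho\<close>, and the two transposes cancel against their evaluations.\<close>

lemma (in monoidal_closed_category) shift_eval_at:
  assumes k: "k \<in> hom C B Y" and B: "B \<in> Obj C" and Y: "Y \<in> Obj C"
  shows "shift C B Y ;; eval_at C B Y k = k"
proof -
  let ?W = "rres C Y B"
  let ?Z = "lres C ?W Y"
  let ?s = "shift C B Y"
  let ?r = "rho C \<one> B (lunit C B ;; k)"
  let ?i = "inv_arrow C (lunit C B)"
  let ?j = "inv_arrow C (lunit C ?Z)"
  have W: "?W \<in> Obj C" by (intro rres_Obj B Y)
  have Z: "?Z \<in> Obj C" by (intro lres_Obj W Y)
  have s: "?s \<in> hom C B ?Z" by (rule shift_hom[OF B Y])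
  have lk: "lunit C B ;; k \<in> hom C (\<one> \<otimes> B) Y" by (rule Comp_hom[OF lunit_hom[OF B] k])
  have r: "?r \<in> hom C \<one> ?W" by (rule rho_hom[OF unitO_Obj B Y lk])
  have i: "?i \<in> hom C B (\<one> \<otimes> B)" by (rule inv_arrow_hom[OF lunit_iso lunit_hom]; rule B)
  have j: "?j \<in> hom C ?Z (\<one> \<otimes> ?Z)" by (rule inv_arrow_hom[OF lunit_iso lunit_hom]; rule Z)
  note ev = evl_hom[OF W Y]
  have rZ: "?r \<otimes>\<^sub>a Idn C ?Z \<in> hom C (\<one> \<otimes> ?Z) (?W \<otimes> ?Z)"
    and rB: "?r \<otimes>\<^sub>a Idn C B \<in> hom C (\<one> \<otimes> B) (?W \<otimes> B)"
    by (intro tensA_hom r Idn_hom Z B)+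
  have s1: "Idn C \<one> \<otimes>\<^sub>a ?s \<in> hom C (\<one> \<otimes> B) (\<one> \<otimes> ?Z)"
    and sW: "Idn C ?W \<otimes>\<^sub>a ?s \<in> hom C (?W \<otimes> B) (?W \<otimes> ?Z)"
    by (intro tensA_hom s Idn_hom unitO_Obj W)+
  note rest = Comp_hom[OF rZ ev]
  have "?s ;; eval_at C B Y k = (?s ;; ?j) ;; ((?r \<otimes>\<^sub>a Idn C ?Z) ;; evl C ?W Y)"
    unfolding eval_at_def Let_def using Comp_assoc[OF s j rest] by simp
  also have "\<dots> = ?i ;; ((Idn C \<one> \<otimes>\<^sub>a ?s) ;; ((?r \<otimes>\<^sub>a Idn C ?Z) ;; evl C ?W Y))"
    using inv_lunit_natural[OF s B Z] Comp_assoc[OF i s1 rest] by simp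
  \<comment> \<open>Interchange brings \<open>shift\<close> next to \<open>evl\<close>; being the
    left transpose of \<open>evr\<close>, it turns \<open>evl\<close> into \<open>evr\<close>,
    against which \<open>rho\<close> then cancels.\<close>
  also have "(Idn C \<one> \<otimes>\<^sub>a ?s) ;; ((?r \<otimes>\<^sub>a Idn C ?Z) ;; evl C ?W Y)
      = (?r \<otimes>\<^sub>a Idn C B) ;; ((Idn C ?W \<otimes>\<^sub>a ?s) ;; evl C ?W Y)"
    using Comp_assoc[OF s1 rZ ev] Comp_assoc[OF rB sW ev]
      tensA_interchange[OF r s unitO_Obj W B Z] by simp
  also have "(Idn C ?W \<otimes>\<^sub>a ?s) ;; evl C ?W Y = evr C Y B"
    unfolding shift_def by (rule lam_evl[OF W B Y evr_hom[OF Y B]])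
  also have "(?r \<otimes>\<^sub>a Idn C B) ;; evr C Y B = lunit C B ;; k"
    by (rule rho_evr[OF unitO_Obj B Y lk])
  \<comment> \<open>The inverse unitor from \<open>eval_at\<close> meets the unitor that made
    \<open>k\<close> a map out of \<open>\<one> \<otimes> B\<close>.\<close>
  also have "?i ;; (lunit C B ;; k) = k"
    using Comp_assoc[OF i lunit_hom[OF B] k] Idn_left[OF k]
      inv_arrow_left[OF lunit_iso[OF B] lunit_hom[OF B]] by simp
  finally show ?thesis .
qed

section \<open>Composition of pullbacks\<close>

lemma (in refinement_system) derivation_Comp:
  assumes "derivation E p S f T \<alpha>" "derivation E p T g V \<beta>"
  shows "derivation E p S (f ;;\<^bsub>I\<^esub> g) V (\<alpha> ;;\<^bsub>E\<^esub> \<beta>)"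
  using assms source.Comp_hom ar_Comp unfolding derivation_def by metis

text \<open>A judgment does not record the type of its expression, but that expression is the image
  under \<open>p\<close> of a typed arrow.\<close>

lemma (in refinement_system) derivation_arrow_hom:
  assumes "derivation E p S f T \<alpha>"
  shows "f \<in> hom I (ob p S) (ob p T)"
  using assms ar_hom unfolding derivation_def by blast

lemma (in refinement_system) exhibits_pullback_Comp:
  assumes l: "exhibits_pullback E I p P f T l" and m: "exhibits_pullback E I p Q g P m"
  shows "exhibits_pullback E I p Q (g ;;\<^bsub>I\<^esub> f) T (m ;;\<^bsub>E\<^esub> l)"
proof -
  obtain R where R: "pullback_structure E I p f T P l R"
    using l by (auto simp: exhibits_pullback_def)
  obtain R' where R': "pullback_structure E I p g P Q m R'"
    using m by (auto simp: exhibits_pullback_def)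
  have dl: "derivation E p P f T l" and dm: "derivation E p Q g P m"
    using R R' by (auto simp: pullback_structure_def)
  have f: "f \<in> hom I (ob p P) (ob p T)" and g: "g \<in> hom I (ob p Q) (ob p P)"
    using derivation_arrow_hom[OF dl] derivation_arrow_hom[OF dm] .
  have gf: "g ;;\<^bsub>I\<^esub> f \<in> hom I (ob p Q) (ob p T)"
    by (rule target.Comp_hom[OF g f])
  have lh: "l \<in> hom E P T" and mh: "m \<in> hom E Q P"
    using dl dm by (auto simp: derivation_def)
  \<comment> \<open>To factor \<beta> over \<open>h\<close>, first factor it through
    \<open>l\<close> over the composite of \<open>h\<close> and \<open>g\<close>, then factor the
    result through \<open>m\<close> over \<open>h\<close>.\<close>
  have "pullback_structure E I p (g ;;\<^bsub>I\<^esub> f) T Q (m ;;\<^bsub>E\<^esub> l)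
      (\<lambda>h \<beta>. R' h (R (h ;;\<^bsub>I\<^esub> g) \<beta>))"
    unfolding pullback_structure_def
  proof (intro conjI allI impI)
    show "g ;;\<^bsub>I\<^esub> f \<in> Arr I" "refines E p T (Cod I (g ;;\<^bsub>I\<^esub> f))" "refines E p Q (Dom I (g ;;\<^bsub>I\<^esub> f))"
      using R R' homD[OF gf] by (auto simp: pullback_structure_def refines_def)
    show "derivation E p Q (g ;;\<^bsub>I\<^esub> f) T (m ;;\<^bsub>E\<^esub> l)"
      by (rule derivation_Comp[OF dm dl])
  next
    fix S h \<beta>
    assume S: "S \<in> Obj E" and "h \<in> hom I (ob p S) (Dom I (g ;;\<^bsub>I\<^esub> f))"
      and "derivation E p S (h ;;\<^bsub>I\<^esub> g ;;\<^bsub>I\<^esub> f) T \<beta>"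
    \<comment> \<open>Rebracketing presents \<beta> as lying over something followed by
      \<open>f\<close>, the form that \<open>R\<close> accepts.\<close>
    then have h: "h \<in> hom I (ob p S) (ob p Q)"
      and \<beta>: "derivation E p S ((h ;;\<^bsub>I\<^esub> g) ;;\<^bsub>I\<^esub> f) T \<beta>"
      using homD[OF gf] target.Comp_assoc[OF _ g f] by auto
    note hg = target.Comp_hom[OF h g]
    have 1: "derivation E p S (h ;;\<^bsub>I\<^esub> g) P (R (h ;;\<^bsub>I\<^esub> g) \<beta>)" "R (h ;;\<^bsub>I\<^esub> g) \<beta> ;;\<^bsub>E\<^esub> l = \<beta>"
      using R S hg \<beta> homD[OF f] by (auto simp: pullback_structure_def)
    have 2: "derivation E p S h Q (R' h (R (h ;;\<^bsub>I\<^esub> g) \<beta>))"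
      "R' h (R (h ;;\<^bsub>I\<^esub> g) \<beta>) ;;\<^bsub>E\<^esub> m = R (h ;;\<^bsub>I\<^esub> g) \<beta>"
      using R' S h 1(1) homD[OF g] by (auto simp: pullback_structure_def)
    show "derivation E p S h Q (R' h (R (h ;;\<^bsub>I\<^esub> g) \<beta>))" by (rule 2)
    have "R' h (R (h ;;\<^bsub>I\<^esub> g) \<beta>) \<in> hom E S Q"
      using 2(1) by (simp add: derivation_def)
    from source.Comp_assoc[OF this mh lh]
    show "R' h (R (h ;;\<^bsub>I\<^esub> g) \<beta>) ;;\<^bsub>E\<^esub> m ;;\<^bsub>E\<^esub> l = \<beta>"
      using 1(2) 2(2) by simp
  next
    fix S h \<eta>
    assume S: "S \<in> Obj E" and "h \<in> hom I (ob p S) (Dom I (g ;;\<^bsub>I\<^esub> f))"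
      and \<eta>: "derivation E p S h Q \<eta>"
    then have h: "h \<in> hom I (ob p S) (ob p Q)"
      using homD[OF gf] by auto
    have "\<eta> \<in> hom E S Q" using \<eta> by (simp add: derivation_def)
    \<comment> \<open>With this bracketing the uniqueness law of \<open>R\<close> strips off
      \<open>l\<close>, and that of \<open>R'\<close> then strips off \<open>m\<close>.\<close>
    then have "\<eta> ;;\<^bsub>E\<^esub> m ;;\<^bsub>E\<^esub> l = (\<eta> ;;\<^bsub>E\<^esub> m) ;;\<^bsub>E\<^esub> l"
      using source.Comp_assoc[OF _ mh lh] by simp
    moreover have "R (h ;;\<^bsub>I\<^esub> g) ((\<eta> ;;\<^bsub>E\<^esub> m) ;;\<^bsub>E\<^esub> l) = \<eta> ;;\<^bsub>E\<^esub> m"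
      using R S target.Comp_hom[OF h g] derivation_Comp[OF \<eta> dm] homD[OF f]
      by (auto simp: pullback_structure_def)
    moreover have "R' h (\<eta> ;;\<^bsub>E\<^esub> m) = \<eta>"
      using R' S h \<eta> homD[OF g] by (auto simp: pullback_structure_def)
    ultimately show "R' h (R (h ;;\<^bsub>I\<^esub> g) (\<eta> ;;\<^bsub>E\<^esub> m ;;\<^bsub>E\<^esub> l)) = \<eta>" by simp
  qed
  then show ?thesis by (auto simp: exhibits_pullback_def)
qed

lemma (in refinement_system) is_pullback_Comp:
  assumes "is_pullback E I p P f T" "is_pullback E I p Q g P"
  shows "is_pullback E I p Q (g ;;\<^bsub>I\<^esub> f) T"
  using assms exhibits_pullback_Comp unfolding is_pullback_def by blast

section \<open>Uniqueness of pullbacks up to vertical isomorphism\<close>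

lemma (in refinement_system) exhibits_pullback_endo_unique:
  assumes l: "exhibits_pullback E I p P f T l"
    and \<alpha>: "derivation E p P (Idn I (ob p P)) P \<alpha>" and eq: "\<alpha> ;;\<^bsub>E\<^esub> l = l"
  shows "\<alpha> = Idn E P"
proof -
  obtain R where R: "pullback_structure E I p f T P l R"
    using l by (auto simp: exhibits_pullback_def)
  have P: "P \<in> Obj E" "Dom I f = ob p P" and lh: "l \<in> hom E P T"
    using R by (auto simp: pullback_structure_def refines_def derivation_def)
  have id: "derivation E p P (Idn I (ob p P)) P (Idn E P)"
    using source.Idn_hom[OF P(1)] ar_Idn[OF P(1)] by (simp add: derivation_def)
  \<comment> \<open>A vertical endomorphism is recovered from its composite with \<open>l\<close>;
    for \<alpha> and for the identity this composite is \<open>l\<close> itself.\<close>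
  have "R (Idn I (ob p P)) (\<gamma> ;;\<^bsub>E\<^esub> l) = \<gamma>" if "derivation E p P (Idn I (ob p P)) P \<gamma>" for \<gamma>
    using R P target.Idn_hom[OF ob_Obj[OF P(1)]] that by (simp add: pullback_structure_def)
  from this[OF \<alpha>] this[OF id] show ?thesis
    using eq source.Idn_left[OF lh] by simp
qed

text \<open>Read \<open>l\<close> as lying over the identity followed by \<open>f\<close>, and
  factor it through \<open>l'\<close>.\<close>

lemma (in refinement_system) exhibits_pullback_compare:
  assumes l: "exhibits_pullback E I p P f T l" and l': "exhibits_pullback E I p P' f T l'"
  obtains \<alpha> where "derivation E p P (Idn I (ob p P)) P' \<alpha>" "\<alpha> ;;\<^bsub>E\<^esub> l' = l"
proof -
  obtain R where R: "pullback_structure E I p f T P' l' R"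
    using l' by (auto simp: exhibits_pullback_def)
  have P: "P \<in> Obj E" "Dom I f = ob p P" and dl: "derivation E p P f T l"
    using l by (auto simp: exhibits_pullback_def pullback_structure_def refines_def)
  have "derivation E p P (Idn I (ob p P) ;;\<^bsub>I\<^esub> f) T l"
    using target.Idn_left[OF derivation_arrow_hom[OF dl]] dl by simp
  then have "derivation E p P (Idn I (ob p P)) P' (R (Idn I (ob p P)) l)"
    "R (Idn I (ob p P)) l ;;\<^bsub>E\<^esub> l' = l"
    using R P target.Idn_hom[OF ob_Obj[OF P(1)]] by (auto simp: pullback_structure_def)
  then show thesis by (rule that)
qed

lemma (in refinement_system) is_pullback_unique:
  assumes "is_pullback E I p P f T" "is_pullback E I p P' f T"
  shows "vertically_isomorphic E I p P P'"
proof -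
  obtain l l' where l: "exhibits_pullback E I p P f T l" and l': "exhibits_pullback E I p P' f T l'"
    using assms by (auto simp: is_pullback_def)
  have P: "P \<in> Obj E" "P' \<in> Obj E" "ob p P' = ob p P"
    using l l' by (auto simp: exhibits_pullback_def pullback_structure_def refines_def)
  let ?id = "Idn I (ob p P)"
  have lh: "l \<in> hom E P T" "l' \<in> hom E P' T"
    using l l' by (auto simp: exhibits_pullback_def pullback_structure_def derivation_def)
  obtain \<alpha> where \<alpha>: "derivation E p P ?id P' \<alpha>" "\<alpha> ;;\<^bsub>E\<^esub> l' = l"
    by (rule exhibits_pullback_compare[OF l l'])
  \<comment> \<open>Since \<open>P\<close> and \<open>P'\<close> refine the same i-type, both
    comparisons lie over the same identity.\<close>
  obtain \<beta> where \<beta>: "derivation E p P' ?id P \<beta>" "\<beta> ;;\<^bsub>E\<^esub> l = l'"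
    using exhibits_pullback_compare[OF l' l] P(3) by metis
  have h: "\<alpha> \<in> hom E P P'" "\<beta> \<in> hom E P' P"
    using \<alpha> \<beta> by (auto simp: derivation_def)
  have id: "?id ;;\<^bsub>I\<^esub> ?id = ?id"
    by (rule target.Idn_left[OF target.Idn_hom[OF ob_Obj[OF P(1)]]])
  \<comment> \<open>The composite is vertical and fixes \<open>l\<close>: \<beta> carries
    \<open>l\<close> to \<open>l'\<close> and \<alpha> carries \<open>l'\<close> back to
    \<open>l\<close>.\<close>
  have "\<alpha> ;;\<^bsub>E\<^esub> \<beta> = Idn E P"
    using exhibits_pullback_endo_unique[OF l] derivation_Comp[OF \<alpha>(1) \<beta>(1)] id
      source.Comp_assoc[OF h lh(1)] \<alpha>(2) \<beta>(2) by simp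
  moreover have "\<beta> ;;\<^bsub>E\<^esub> \<alpha> = Idn E P'"
    using exhibits_pullback_endo_unique[OF l'] derivation_Comp[OF \<beta>(1) \<alpha>(1)] id P(3)
      source.Comp_assoc[OF h(2) h(1) lh(2)] \<alpha>(2) \<beta>(2) by simp
  ultimately show ?thesis
    using \<alpha> \<beta> P unfolding vertically_isomorphic_def vertical_iso_def refines_def by blast
qed

section \<open>Both sides as pullbacks of one e-type\<close>

lemma (in fibration) is_pullback_pb:
  assumes "f \<in> hom I A B" "refines E p T B"
  shows "is_pullback E I p (pb K f T) f T"
  using has_pullbacks[OF assms] unfolding is_pullback_def exhibits_pullback_def by blast

lemma preserves_pullbacks_is_pullback:
  assumes "preserves_pullbacks D J q E I p R0 R1" "is_pullback D J q S f T"
  shows "is_pullback E I p (ob R1 S) (ar R0 f) (ob R1 T)"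
  using assms unfolding preserves_pullbacks_def is_pullback_def by blast

theorem mainTheorem1:
  fixes E :: "('eo, 'ea) closed_cat" and I :: "('io, 'ia) closed_cat"
    and p :: "('eo, 'ea, 'io, 'ia) monoidal_functor"
    and K :: "('eo, 'ea, 'ia) cleavage"
    and D :: "('do, 'da) cat" and J :: "('jo, 'ja) cat"
    and q :: "('do, 'da, 'jo, 'ja) cfunctor"
    and L0 :: "('io, 'ia, 'jo, 'ja) cfunctor" and R0 :: "('jo, 'ja, 'io, 'ia) cfunctor"
    and \<eta>0 :: "'io \<Rightarrow> 'ia" and \<epsilon>0 :: "'jo \<Rightarrow> 'ja"
    and L1 :: "('eo, 'ea, 'do, 'da) cfunctor" and R1 :: "('do, 'da, 'eo, 'ea) cfunctor"
    and \<eta>1 :: "'eo \<Rightarrow> 'ea" and \<epsilon>1 :: "'do \<Rightarrow> 'da"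
    and U :: 'do and C :: 'jo and e :: "'do \<Rightarrow> 'ja"
    and T :: 'eo and B :: 'io
  assumes "monoidal_closed_fibration E I p K"
    and "refinement_system D J q"
    and "refinement_adjunction E I p D J q L0 R0 \<eta>0 \<epsilon>0 L1 R1 \<eta>1 \<epsilon>1"
    and "gives_strong_monad E I p L0 R0 \<eta>0 \<epsilon>0 L1 R1 \<eta>1 \<epsilon>1"
    and "refines D q U C"
    and "universal_type D J q U e"
    and "reflected E I p D J q R0 \<eta>0 L1 R1 U e"
    and "refines E p T B"
  shows "vertically_isomorphic E I p
           (pb K (\<eta>0 B) (ob R1 (ob L1 T)))
           (pb K (shift I B (ob R0 C)) (lres E (rres E (ob R1 U) T) (ob R1 U)))"
proof -
  interpret monoidal_closed_fibration E I p K by fact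
  interpret adj: refinement_adjunction E I p D J q L0 R0 \<eta>0 \<epsilon>0 L1 R1 \<eta>1 \<epsilon>1 by fact
  let ?S = "ob L1 T" and ?V = "ob R1 U" and ?Y = "ob R0 C"
  let ?W = "lres E (rres E ?V T) ?V"
  let ?k = "\<eta>0 B ;;\<^bsub>I\<^esub> ar R0 (e ?S)"
  have T: "T \<in> Obj E" "ob p T = B" and B: "B \<in> Obj I"
    using \<open>refines E p T B\<close> ob_Obj by (auto simp: refines_def)
  have U: "U \<in> Obj D" "ob q U = C" and C: "C \<in> Obj J"
    using \<open>refines D q U C\<close> adj.q.ob_Obj by (auto simp: refines_def)
  have S: "?S \<in> Obj D" "ob q ?S = ob L0 B"
    using T adj.total.left.ob_Obj adj.q_L1_ob by auto
  have Y: "?Y \<in> Obj I" by (rule adj.base.right.ob_Obj[OF C])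
  have V: "refines E p ?V ?Y"
    using U adj.total.right.ob_Obj adj.p_R1_ob by (auto simp: refines_def)
  \<comment> \<open>As \<open>L1\<close> lies over \<open>L0\<close> and \<open>R1\<close> over
    \<open>R0\<close>, this e-type refines the codomain of the unit at \<open>B\<close>, so it can
    be pulled back along that unit.\<close>
  have RS: "refines E p (ob R1 ?S) (ob R0 (ob L0 B))"
    using S adj.total.right.ob_Obj adj.p_R1_ob by (auto simp: refines_def)
  have "encoding D J q ?S U (e ?S)"
    using \<open>universal_type D J q U e\<close> S(1) by (simp add: universal_type_def)
  then have e: "e ?S \<in> hom J (ob L0 B) C" "is_pullback D J q ?S (e ?S) U"
    using S U by (auto simp: encoding_def)
  have \<eta>: "\<eta>0 B \<in> hom I B (ob R0 (ob L0 B))" by (rule adj.base.unit_hom[OF B])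
  have k: "?k \<in> hom I B ?Y" by (rule target.Comp_hom[OF \<eta> adj.base.right.ar_hom[OF e(1)]])
  have W: "refines E p ?W (lres I (rres I ?Y B) ?Y)"
    by (intro lres_refines rres_refines V \<open>refines E p T B\<close>)
  have reflects: "preserves_pullbacks D J q E I p R0 R1"
    "is_pullback E I p ?W (eval_at I B ?Y ?k) ?V"
    using \<open>reflected E I p D J q R0 \<eta>0 L1 R1 U e\<close> \<open>refines E p T B\<close> U(2)
    by (auto simp: reflected_def)
  \<comment> \<open>Left side: the image under \<open>R\<close> of the encoding square of
    \<open>L1 T\<close>, pasted with the chosen pullback along the unit.\<close>
  have "is_pullback E I p (pb K (\<eta>0 B) (ob R1 ?S)) ?k ?V"
    by (rule is_pullback_Comp[OF preserves_pullbacks_is_pullback[OF reflects(1) e(2)]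
          is_pullback_pb[OF \<eta> RS]])
  \<comment> \<open>Right side: the reflection square at \<open>T\<close>, pasted with the chosen
    pullback along \<open>shift\<close>.\<close>
  moreover have "is_pullback E I p (pb K (shift I B ?Y) ?W) ?k ?V"
    using is_pullback_Comp[OF reflects(2) is_pullback_pb[OF base.shift_hom[OF B Y] W]]
      base.shift_eval_at[OF k B Y] by simp
  ultimately show ?thesis by (rule is_pullback_unique)
qed

end
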